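(* For all integers $n\geq 3$, $\overline{p}_{\mathrm{eu}}^{\mathrm{ou}}(2n)<\overline{p}^{\mathrm{eu}}_{\mathrm{ou}}(2n+1)$.
   Context: A partition of a non-negative integer $m$ is a non-increasing finite sequence of positive integers, called parts, summing to $m$. The multiplicity of a part is the number of times it occurs. $\overline{p}_{\mathrm{eu}}^{\mathrm{ou}}(m)$ is the number of partitions of $m$ in which every odd part is larger than every even part, the largest even part appears with odd multiplicity, and all other parts (even or odd) appear with even multiplicity. Partitions with no odd parts are allowed. Partitions with only odd parts are also allowed: such a partition is regarded as having a single even part equal to $0$ with multiplicity one, so it is counted exactly when all of its (odd) parts appear with even multiplicity. $\overline{p}^{\mathrm{eu}}_{\mathrm{ou}}(m)$ is the number of partitions of $m$ in which every even part is larger than every odd part, both even and odd parts occur (at least one of each), the largest even part and the largest odd part each appear with odd multiplicity, and all other parts appear with even multiplicity. *)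

theory Defs
  imports Main
begin

definition is_partition :: "nat \<Rightarrow> nat list \<Rightarrow> bool" where
  "is_partition m xs \<longleftrightarrow> sorted_wrt (\<ge>) xs \<and> (\<forall>x\<in>set xs. 0 < x) \<and> sum_list xs = m"

text \<open>Meaningful only if \<open>xs\<close> has a part of the respective parity.\<close>

definition largest_even :: "nat list \<Rightarrow> nat" where
  "largest_even xs = Max {x \<in> set xs. even x}"

definition largest_odd :: "nat list \<Rightarrow> nat" where
  "largest_odd xs = Max {x \<in> set xs. odd x}"

text \<open>
  The letters in the names give the parity of the parts (\<open>e\<close> or \<open>o\<close>), the smaller ones first;
  \<open>u\<close> stands for unrestricted parts (repetition allowed) and \<open>bar\<close> for the overline.

  In the first definition the \<open>else\<close> branch is the convention that a partition without even parts
  has a single even part 0 of multiplicity one: the condition on the largest even part then holds,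
  and all the actual parts are other parts. Under this reading the empty partition is counted for
  \<open>m = 0\<close>.
\<close>

definition eu_ou_bar_partition :: "nat \<Rightarrow> nat list \<Rightarrow> bool" where
  "eu_ou_bar_partition m xs \<longleftrightarrow>
     is_partition m xs \<and>
     (\<forall>x\<in>set xs. \<forall>y\<in>set xs. odd x \<and> even y \<longrightarrow> y < x) \<and>
     (if \<exists>x\<in>set xs. even x
      then odd (count_list xs (largest_even xs)) \<and>
           (\<forall>x\<in>set xs. x \<noteq> largest_even xs \<longrightarrow> even (count_list xs x))
      else \<forall>x\<in>set xs. even (count_list xs x))"

definition ou_eu_bar_partition :: "nat \<Rightarrow> nat list \<Rightarrow> bool" where
  "ou_eu_bar_partition m xs \<longleftrightarrow>
     is_partition m xs \<and>
     (\<forall>x\<in>set xs. \<forall>y\<in>set xs. even x \<and> odd y \<longrightarrow> y < x) \<and>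
     (\<exists>x\<in>set xs. even x) \<and> (\<exists>x\<in>set xs. odd x) \<and>
     odd (count_list xs (largest_even xs)) \<and>
     odd (count_list xs (largest_odd xs)) \<and>
     (\<forall>x\<in>set xs. x \<noteq> largest_even xs \<and> x \<noteq> largest_odd xs \<longrightarrow> even (count_list xs x))"

definition p_eu_ou_bar :: "nat \<Rightarrow> nat" where
  "p_eu_ou_bar m = card {xs. eu_ou_bar_partition m xs}"

definition p_ou_eu_bar :: "nat \<Rightarrow> nat" where
  "p_ou_eu_bar m = card {xs. ou_eu_bar_partition m xs}"

text \<open>Both cardinalities are of finite sets, so \<open>card\<close> counts as intended.\<close>

lemma finite_partitions: "finite {xs. is_partition m xs}"
proof (rule finite_subset)
  have len: "length xs \<le> sum_list xs" if "\<forall>x\<in>set xs. 0 < x" for xs :: "nat list"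
    using that by (induction xs) auto
  show "{xs. is_partition m xs} \<subseteq> {xs. set xs \<subseteq> {..m} \<and> length xs \<le> m}"
    using len by (auto simp: is_partition_def dest: member_le_sum_list)
  show "finite {xs. set xs \<subseteq> {..m} \<and> length xs \<le> m}"
    by (rule finite_lists_length_le) simp
qed

lemma finite_eu_ou_bar_partitions: "finite {xs. eu_ou_bar_partition m xs}"
  by (rule finite_subset[OF _ finite_partitions[of m]]) (auto simp: eu_ou_bar_partition_def)

lemma finite_ou_eu_bar_partitions: "finite {xs. ou_eu_bar_partition m xs}"
  by (rule finite_subset[OF _ finite_partitions[of m]]) (auto simp: ou_eu_bar_partition_def)

end

theory Submission
  imports Defs "HOL-Computational_Algebra.Formal_Power_Series" "HOL-Library.Multiset"
begin

text \<open>
  Let \<open>Q m\<close> be the number of partitions of \<open>m\<close> into odd parts. Halving multiplicities gives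
  $$\sum_n p(2n)\, q^n = \sum_a \frac{q^a}{(q^2;q^2)_a\,(q^{2a+1};q^2)_\infty}
     = \frac{1}{(q;q^2)_\infty} \sum_a q^a \frac{(q;q^2)_a}{(q^2;q^2)_a}$$
  for the left-hand side \<open>p\<close> of the inequality. By a telescoping argument of Shanks the last sum is
  Gauss's series $\sum_k q^{k(k+1)/2}$, so \<open>p (2 n)\<close> is the sum of \<open>Q (n - t)\<close> over the triangular
  numbers \<open>t \<le> n\<close>. Since 2 is not triangular and \<open>Q 0 \<le> Q (n - 2)\<close>, this is at most
  \<open>Q 1 + \<dots> + Q n\<close>. On the right-hand side, the partitions whose only odd part is 1 are generated by
  $\frac{1}{1-q} \sum_{b \ge 1} q^b / (q^2;q^2)_b$, which by Euler's identity counts exactly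
  \<open>Q 1 + \<dots> + Q n\<close> of them, and at least one further partition has a part 3.
\<close>

unbundle fps_syntax

section \<open>Generating functions of partitions with restricted parts\<close>

definition parts_in :: "nat set \<Rightarrow> nat \<Rightarrow> nat multiset set" where
  "parts_in S m = {M. set_mset M \<subseteq> S \<and> sum_mset M = m}"

lemma finite_parts_in:
  assumes "0 \<notin> S"
  shows "finite (parts_in S m)"
proof (rule finite_subset)
  show "finite (mset ` {xs. set xs \<subseteq> {..m} \<and> length xs \<le> m})"
    by (intro finite_imageI finite_lists_length_le) simp
  show "parts_in S m \<subseteq> mset ` {xs. set xs \<subseteq> {..m} \<and> length xs \<le> m}"
  proof
    fix M assume M: "M \<in> parts_in S m"
    obtain xs where xs: "mset xs = M" using ex_mset by blast
    have len: "length ys \<le> sum_list ys" if "0 \<notin> set ys" for ys :: "nat list"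
      using that by (induction ys) auto
    have sum: "sum_list xs = m" and pos: "0 \<notin> set xs"
      using M xs assms by (auto simp: parts_in_def sum_mset_sum_list)
    have "set xs \<subseteq> {..m}" using member_le_sum_list[of _ xs] sum by auto
    moreover have "length xs \<le> m" using len[OF pos] sum by simp
    ultimately show "M \<in> mset ` {xs. set xs \<subseteq> {..m} \<and> length xs \<le> m}"
      using xs by blast
  qed
qed

text \<open>For \<open>S\<close> without 0 this serves as the possibly infinite product of
  $1/(1-q^s)$, so no limits are taken; integer coefficients allow subtraction.\<close>

definition parts_gf :: "nat set \<Rightarrow> int fps" where
  "parts_gf S = Abs_fps (\<lambda>m. int (card (parts_in S m)))"

lemma parts_gf_nth: "parts_gf S $ m = int (card (parts_in S m))"
  by (simp add: parts_gf_def)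

lemma parts_gf_empty: "parts_gf {} = 1"
proof (rule fps_ext)
  fix m
  have "parts_in {} m = (if m = 0 then {{#}} else {})" by (auto simp: parts_in_def)
  then show "parts_gf {} $ m = 1 $ m" by (simp add: parts_gf_nth)
qed

lemma parts_gf_nth_0: "0 \<notin> S \<Longrightarrow> parts_gf S $ 0 = 1"
proof -
  assume S: "0 \<notin> S"
  have "N = {#}" if "set_mset N \<subseteq> S" "sum_mset N = 0" for N
    using that S by (cases N) auto
  then have "parts_in S 0 = {{#}}" by (auto simp: parts_in_def)
  then show ?thesis by (simp add: parts_gf_nth)
qed

text \<open>A multiset over \<open>S\<close> either omits \<open>s\<close> or loses one copy of
  \<open>s\<close> to become a multiset of sum \<open>m - s\<close>. The product formulas below
  iterate this.\<close>

lemma parts_gf_remove: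
  assumes "s \<in> S" "0 \<notin> S"
  shows "(1 - fps_X ^ s) * parts_gf S = parts_gf (S - {s})"
proof (rule fps_ext)
  fix m
  have fin: "finite (parts_in S k)" "finite (parts_in (S - {s}) k)" for k
    using assms by (auto intro: finite_parts_in)
  have "int (card (parts_in S m)) =
      int (card (parts_in (S - {s}) m)) + (if m < s then 0 else int (card (parts_in S (m - s))))"
  proof (cases "m < s")
    case True
    have "s \<notin># M" if "sum_mset M = m" for M
    proof
      assume "s \<in># M"
      then obtain N where "M = add_mset s N" by (meson multi_member_split)
      then show False using True that by simp
    qed
    then have "parts_in S m = parts_in (S - {s}) m"
      by (auto simp: parts_in_def)
    then show ?thesis using True by simp
  next
    case False
    have "parts_in S m = parts_in (S - {s}) m \<union> add_mset s ` parts_in S (m - s)"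
    proof (intro set_eqI iffI)
      fix M assume M: "M \<in> parts_in S m"
      show "M \<in> parts_in (S - {s}) m \<union> add_mset s ` parts_in S (m - s)"
      proof (cases "s \<in># M")
        case True
        then obtain N where "M = add_mset s N" by (meson multi_member_split)
        then show ?thesis using M by (auto simp: parts_in_def)
      qed (use M in \<open>auto simp: parts_in_def\<close>)
    next
      fix M assume "M \<in> parts_in (S - {s}) m \<union> add_mset s ` parts_in S (m - s)"
      then show "M \<in> parts_in S m" using False assms by (auto simp: parts_in_def)
    qed
    moreover have "parts_in (S - {s}) m \<inter> add_mset s ` parts_in S (m - s) = {}"
    proof -
      have "s \<notin># M" if "M \<in> parts_in (S - {s}) m" for M
        using that by (auto simp: parts_in_def)
      then show ?thesis by fastforce
    qed
    ultimately show ?thesis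
      using fin False by (simp add: card_Un_disjoint card_image inj_on_def)
  qed
  then show "((1 - fps_X ^ s) * parts_gf S) $ m = parts_gf (S - {s}) $ m"
    by (simp add: left_diff_distrib fps_X_power_mult_nth parts_gf_nth)
qed

text \<open>For finite \<open>T\<close> without 0 its inverse is \<open>parts_gf T\<close>, so
  quotients are written as products.\<close>

definition euler_prod :: "nat set \<Rightarrow> int fps" where
  "euler_prod T = (\<Prod>t\<in>T. 1 - fps_X ^ t)"

lemma euler_prod_mult_parts_gf:
  assumes "finite T" "T \<subseteq> S" "0 \<notin> S"
  shows "euler_prod T * parts_gf S = parts_gf (S - T)"
  using assms
proof (induction T)
  case (insert t T)
  have "euler_prod (insert t T) * parts_gf S = (1 - fps_X ^ t) * parts_gf (S - T)"
    using insert by (simp add: euler_prod_def mult.assoc)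
  also have "\<dots> = parts_gf (S - T - {t})"
    using insert by (intro parts_gf_remove) auto
  also have "S - T - {t} = S - insert t T" by auto
  finally show ?case .
qed (simp add: euler_prod_def)

lemma euler_prod_mult_parts_gf_self:
  assumes "finite T" "0 \<notin> T"
  shows "euler_prod T * parts_gf T = 1"
  using euler_prod_mult_parts_gf[of T T] assms by (simp add: parts_gf_empty)

section \<open>The finite products $(q^2;q^2)_a$ and $(q;q^2)_a$ and their quotients\<close>

definition evens_upto :: "nat \<Rightarrow> nat set" where
  "evens_upto a = {k. even k \<and> 0 < k \<and> k \<le> 2 * a}"

definition odds_below :: "nat \<Rightarrow> nat set" where
  "odds_below a = {k. odd k \<and> k < 2 * a}"

lemma evens_upto_0 [simp]: "evens_upto 0 = {}" and odds_below_0 [simp]: "odds_below 0 = {}"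
  by (auto simp: evens_upto_def odds_below_def)

lemma evens_upto_Suc: "evens_upto (Suc a) = insert (2 * a + 2) (evens_upto a)"
  unfolding evens_upto_def by (rule set_eqI, unfold mem_Collect_eq insert_iff) presburger

lemma odds_below_Suc: "odds_below (Suc a) = insert (2 * a + 1) (odds_below a)"
  unfolding odds_below_def by (rule set_eqI, unfold mem_Collect_eq insert_iff) presburger

lemma finite_evens_upto [simp]: "finite (evens_upto a)"
  and finite_odds_below [simp]: "finite (odds_below a)"
  by (rule finite_subset[of _ "{..2 * a}"]; force simp: evens_upto_def odds_below_def)+

lemma zero_notin_evens_upto [simp]: "0 \<notin> evens_upto a"
  and zero_notin_odds_below [simp]: "0 \<notin> odds_below a"
  by (auto simp: evens_upto_def odds_below_def)

lemma new_part_notin_evens [simp]: "Suc (Suc (2 * a)) \<notin> evens_upto a"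
  and new_part_notin_odds [simp]: "Suc (2 * a) \<notin> odds_below a"
  by (simp_all add: evens_upto_def odds_below_def)

lemma euler_prod_evens_Suc:
  "euler_prod (evens_upto (Suc a)) = (1 - fps_X ^ (2 * a + 2)) * euler_prod (evens_upto a)"
  by (simp add: evens_upto_Suc euler_prod_def del: power_Suc)

lemma euler_prod_odds_Suc:
  "euler_prod (odds_below (Suc a)) = (1 - fps_X ^ (2 * a + 1)) * euler_prod (odds_below a)"
  by (simp add: odds_below_Suc euler_prod_def del: power_Suc)

lemma parts_gf_evens_Suc:
  "(1 - fps_X ^ (2 * a + 2)) * parts_gf (evens_upto (Suc a)) = parts_gf (evens_upto a)"
  using parts_gf_remove[of "2 * a + 2" "evens_upto (Suc a)"]
  by (simp add: evens_upto_Suc del: power_Suc)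

lemma parts_gf_odds_Suc:
  "(1 - fps_X ^ (2 * a + 1)) * parts_gf (odds_below (Suc a)) = parts_gf (odds_below a)"
  using parts_gf_remove[of "2 * a + 1" "odds_below (Suc a)"]
  by (simp add: odds_below_Suc del: power_Suc)

text \<open>In $q$-series notation, $P_a = (q^2;q^2)_a / (q;q^2)_a$ and $R_a = 1/P_a$.\<close>

definition gauss_P :: "nat \<Rightarrow> int fps" where
  "gauss_P a = euler_prod (evens_upto a) * parts_gf (odds_below a)"

definition gauss_R :: "nat \<Rightarrow> int fps" where
  "gauss_R a = euler_prod (odds_below a) * parts_gf (evens_upto a)"

lemma gauss_P_0 [simp]: "gauss_P 0 = 1"
  by (simp add: gauss_P_def euler_prod_def parts_gf_empty)

lemma gauss_P_mult_R: "gauss_P a * gauss_R a = 1"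
proof -
  have "gauss_P a * gauss_R a = (euler_prod (evens_upto a) * parts_gf (evens_upto a)) *
      (euler_prod (odds_below a) * parts_gf (odds_below a))"
    by (simp add: gauss_P_def gauss_R_def ac_simps)
  then show ?thesis by (simp add: euler_prod_mult_parts_gf_self)
qed

lemma gauss_P_Suc:
  "(1 - fps_X ^ (2 * a + 1)) * gauss_P (Suc a) = (1 - fps_X ^ (2 * a + 2)) * gauss_P a"
  unfolding gauss_P_def euler_prod_evens_Suc parts_gf_odds_Suc[symmetric, of a] by (simp only: ac_simps)

lemma gauss_R_Suc:
  "(1 - fps_X ^ (2 * a + 2)) * gauss_R (Suc a) = (1 - fps_X ^ (2 * a + 1)) * gauss_R a"
  unfolding gauss_R_def euler_prod_odds_Suc parts_gf_evens_Suc[symmetric, of a] by (simp only: ac_simps)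

section \<open>Gauss's triangular number series\<close>

text \<open>
  Multiplied by $P_n$, this sum depends on \<open>n\<close> only through terms divisible by $q^M$; \<open>n = 0\<close> is the
  sum to be evaluated, and \<open>n = M\<close> is Shanks's finite form of Gauss's identity.
\<close>

definition shanks_sum :: "nat \<Rightarrow> nat \<Rightarrow> int fps" where
  "shanks_sum n M = (\<Sum>s<M. fps_X ^ (s * (2 * n + 1)) * gauss_R s)"

text \<open>Put $z=q^{2n+1}$ and $w=q^{2M}$. By \<open>gauss_R_Suc\<close>, appending the term
  \<open>s = M\<close> reduces to $1-z = (1-qz)w - (1-qw)z + (1-w)$.\<close>

lemma shanks_sum_step:
  "(1 - fps_X ^ (2 * n + 1)) * shanks_sum n M =
   (1 - fps_X ^ (2 * n + 2)) * shanks_sum (Suc n) M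
     - (1 - fps_X ^ (2 * M)) * gauss_R M * fps_X ^ (M * (2 * n + 1))"
proof (induction M)
  case (Suc M)
  define z where "z = (fps_X :: int fps) ^ (2 * n + 1)"
  define w where "w = (fps_X :: int fps) ^ (2 * M)"
  have e: "fps_X ^ (2 * n + 2) = fps_X * z" "fps_X ^ (M * (2 * n + 1)) = z ^ M"
    "fps_X ^ (Suc M * (2 * n + 1)) = z * z ^ M"
    "fps_X ^ (M * (2 * Suc n + 1)) = w * z ^ M" "fps_X ^ (2 * M + 1) = fps_X * w"
    "fps_X ^ (2 * n + 1) = z" "fps_X ^ (2 * M) = w"
    unfolding z_def w_def power_mult[symmetric] power_add[symmetric] power_Suc[symmetric]
    by (rule arg_cong[where f = "\<lambda>k. fps_X ^ k"]; simp)+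
  have s: "(1 - fps_X ^ (2 * Suc M)) * gauss_R (Suc M) = (1 - fps_X * w) * gauss_R M"
    using gauss_R_Suc[of M] unfolding e(5) by simp
  have IH: "(1 - z) * shanks_sum n M =
      (1 - fps_X * z) * shanks_sum (Suc n) M - (1 - w) * gauss_R M * z ^ M"
    using Suc unfolding e .
  show ?case
    unfolding s e using IH unfolding shanks_sum_def sum.lessThan_Suc e
    by (simp add: algebra_simps)
qed (simp add: shanks_sum_def)

definition gauss_sum :: "nat \<Rightarrow> nat \<Rightarrow> int fps" where
  "gauss_sum n M = gauss_P n * shanks_sum n M"

text \<open>By \<open>gauss_P_Suc\<close> and \<open>shanks_sum_step\<close> the two multiples of
  \<open>shanks_sum (Suc n) M\<close> cancel; what remains is a multiple of $q^M$.\<close>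

lemma gauss_sum_step:
  "(1 - fps_X ^ (2 * n + 1)) * (gauss_sum (Suc n) M - gauss_sum n M) =
     gauss_P n * (1 - fps_X ^ (2 * M)) * gauss_R M * fps_X ^ (M * (2 * n + 1))"
proof -
  let ?y = "(1 - fps_X ^ (2 * n + 1)) :: int fps"
  have "?y * (gauss_sum (Suc n) M - gauss_sum n M) =
      (?y * gauss_P (Suc n)) * shanks_sum (Suc n) M - gauss_P n * (?y * shanks_sum n M)"
    by (simp add: gauss_sum_def algebra_simps)
  also have "\<dots> = gauss_P n * (1 - fps_X ^ (2 * M)) * gauss_R M * fps_X ^ (M * (2 * n + 1))"
    unfolding gauss_P_Suc shanks_sum_step by (simp add: algebra_simps)
  finally show ?thesis .
qed

lemma one_minus_X_power_neq_0: "(1 - fps_X ^ Suc k :: int fps) \<noteq> 0"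
proof
  assume "(1 - fps_X ^ Suc k :: int fps) = 0"
  then have "(1 - fps_X ^ Suc k :: int fps) $ 0 = 0" by simp
  then show False by simp
qed

text \<open>Raising \<open>M\<close> from \<open>n\<close> to \<open>n + 1\<close> adds $P_n R_n
  q^{n(2n+1)}$, the triangular power with \<open>k = 2 * n\<close>; raising the first argument then
  adds the one with \<open>k = 2 * n + 1\<close>.\<close>

lemma gauss_sum_diagonal: "gauss_sum n n = (\<Sum>k<2 * n. fps_X ^ (k * (k + 1) div 2))"
proof (induction n)
  case 0
  show ?case by (simp add: gauss_sum_def shanks_sum_def)
next
  case (Suc n)
  let ?y = "(1 - fps_X ^ (2 * n + 1)) :: int fps"
  have "?y * (gauss_sum (Suc n) (Suc n) - gauss_sum n (Suc n)) =
      ((1 - fps_X ^ (2 * n + 2)) * gauss_P n) * gauss_R (Suc n) * fps_X ^ (Suc n * (2 * n + 1))"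
    unfolding gauss_sum_step by (simp add: mult_ac)
  also have "\<dots> = ?y * (gauss_P (Suc n) * gauss_R (Suc n)) * fps_X ^ (Suc n * (2 * n + 1))"
    unfolding gauss_P_Suc[symmetric] by (simp only: mult_ac)
  also have "\<dots> = ?y * fps_X ^ (Suc n * (2 * n + 1))"
    by (simp only: gauss_P_mult_R mult_1_right)
  finally have "gauss_sum (Suc n) (Suc n) - gauss_sum n (Suc n) = fps_X ^ (Suc n * (2 * n + 1))"
    using one_minus_X_power_neq_0[of "2 * n"] by simp
  moreover have "gauss_sum n (Suc n) = gauss_sum n n + fps_X ^ (n * (2 * n + 1)) * (gauss_P n * gauss_R n)"
    by (simp add: gauss_sum_def shanks_sum_def algebra_simps)
  moreover have "2 * n * (2 * n + 1) div 2 = n * (2 * n + 1)" by simp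
  moreover have "(2 * n + 1) * (2 * n + 1 + 1) div 2 = Suc n * (2 * n + 1)"
  proof -
    have "(2 * n + 1) * (2 * n + 1 + 1) = 2 * (Suc n * (2 * n + 1))" by (simp add: algebra_simps)
    then show ?thesis by simp
  qed
  ultimately show ?case
    using Suc by (simp add: gauss_P_mult_R algebra_simps)
qed

text \<open>The factor is a unit with inverse \<open>parts_gf {Suc k}\<close>.\<close>

lemma dvd_cancel_one_minus_X_power:
  assumes "d dvd (1 - fps_X ^ Suc k) * (f :: int fps)"
  shows "d dvd f"
proof -
  have "euler_prod {Suc k} * parts_gf {Suc k} = 1"
    by (rule euler_prod_mult_parts_gf_self) auto
  then have "f = ((1 - fps_X ^ Suc k) * f) * parts_gf {Suc k}"
    by (simp add: euler_prod_def mult_ac)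
  then show ?thesis using assms by (metis dvd_mult2)
qed

lemma gauss_sum_cong: "fps_X ^ M dvd gauss_sum n M - gauss_sum 0 M"
proof (induction n)
  case (Suc n)
  have "fps_X ^ M dvd (1 - fps_X ^ Suc (2 * n)) * (gauss_sum (Suc n) M - gauss_sum n M)"
    using gauss_sum_step[of n M] by (simp add: power_add dvd_mult)
  then have "fps_X ^ M dvd gauss_sum (Suc n) M - gauss_sum n M"
    by (rule dvd_cancel_one_minus_X_power)
  from dvd_add[OF this Suc] show ?case by simp
qed simp

lemma nth_eq_of_X_power_dvd_diff:
  assumes "fps_X ^ M dvd f - (g :: int fps)" "k < M"
  shows "f $ k = g $ k"
proof -
  obtain h where "f - g = fps_X ^ M * h" using assms by (auto elim: dvdE)
  then have "(f - g) $ k = (fps_X ^ M * h) $ k" by simp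
  then show ?thesis using assms(2) by (simp add: fps_X_power_mult_nth)
qed

text \<open>Modulo $q^M$ the sum at \<open>n = 0\<close> agrees with the diagonal value at
  \<open>n = M\<close>, which has a closed form.\<close>

lemma shanks_sum_0_nth:
  assumes "m < M"
  shows "shanks_sum 0 M $ m = int (card {k. k < 2 * M \<and> k * (k + 1) div 2 = m})"
proof -
  have "shanks_sum 0 M $ m = gauss_sum 0 M $ m" by (simp add: gauss_sum_def)
  also have "\<dots> = gauss_sum M M $ m"
    using nth_eq_of_X_power_dvd_diff[OF gauss_sum_cong assms] by metis
  also have "\<dots> = (\<Sum>k<2 * M. if k * (k + 1) div 2 = m then 1 else 0)"
    unfolding gauss_sum_diagonal fps_sum_nth by (intro sum.cong) (auto simp: fps_X_power_nth)
  also have "\<dots> = int (card {k. k < 2 * M \<and> k * (k + 1) div 2 = m})"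
    by (subst sum.inter_filter[symmetric]) (auto intro!: arg_cong[where f = card])
  finally show ?thesis .
qed

text \<open>A nonempty multiset over \<open>S\<close> has sum at least \<open>M\<close>. This
  replaces the convergence to 1 of the tails of an infinite product.\<close>

lemma X_power_dvd_parts_gf_minus_1:
  assumes "\<And>k. k \<in> S \<Longrightarrow> M \<le> k" "0 < M"
  shows "fps_X ^ M dvd parts_gf S - 1"
proof -
  have "(parts_gf S - 1) $ k = 0" if "k < M" for k
  proof (cases "k = 0")
    case True
    have "0 \<notin> S" using assms by force
    then show ?thesis using True by (simp add: parts_gf_nth_0)
  next
    case False
    have "sum_mset N \<noteq> k" if "set_mset N \<subseteq> S" for N
    proof (cases N)
      case (add x N')
      then have "M \<le> x" using that assms(1) by simp
      then show ?thesis using add \<open>k < M\<close> by simp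
    qed (use False in simp)
    then have "parts_in S k = {}" by (auto simp: parts_in_def)
    then show ?thesis using False by (simp add: parts_gf_nth)
  qed
  then have "fps_cutoff M (parts_gf S - 1) = 0" by (intro fps_ext) simp
  then have "fps_X ^ M * fps_shift M (parts_gf S - 1) = parts_gf S - 1"
    using fps_shift_cutoff'[of M "parts_gf S - 1"] by (simp add: mult.commute)
  then show ?thesis by (metis dvd_triv_left)
qed

section \<open>Euler's sum for partitions into odd parts\<close>

text \<open>Euler's series $F(z)$, the sum of all $z^s/(q^2;q^2)_s$, truncated and taken at
  $z=q^{2n+1}$.\<close>

definition euler_sum :: "nat \<Rightarrow> nat \<Rightarrow> int fps" where
  "euler_sum n M = (\<Sum>s<M. fps_X ^ (s * (2 * n + 1)) * parts_gf (evens_upto s))"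

text \<open>This is $(1-z) F(z) = F(q^2 z)$ for the truncated series: since $(1-q^{2s})/(q^2;q^2)_s
  = 1/(q^2;q^2)_{s-1}$, the differences telescope to one boundary term.\<close>

lemma euler_sum_step:
  "(1 - fps_X ^ (2 * n + 1)) * euler_sum n (Suc M) =
   euler_sum (Suc n) (Suc M) - fps_X ^ (Suc M * (2 * n + 1)) * parts_gf (evens_upto M)"
proof (induction M)
  case 0
  show ?case by (simp add: euler_sum_def parts_gf_empty)
next
  case (Suc M)
  define z where "z = (fps_X :: int fps) ^ (2 * n + 1)"
  define w where "w = (fps_X :: int fps) ^ (2 * M + 2)"
  have e: "fps_X ^ (Suc M * (2 * n + 1)) = z ^ Suc M"
    "fps_X ^ (Suc (Suc M) * (2 * n + 1)) = z * z ^ Suc M"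
    "fps_X ^ (Suc M * (2 * Suc n + 1)) = w * z ^ Suc M"
    "fps_X ^ (2 * n + 1) = z"
    unfolding z_def w_def power_mult[symmetric] power_add[symmetric] power_Suc[symmetric]
    by (rule arg_cong[where f = "\<lambda>k. fps_X ^ k"]; simp)+
  have s: "parts_gf (evens_upto M) = (1 - w) * parts_gf (evens_upto (Suc M))"
    using parts_gf_evens_Suc[of M] by (simp only: w_def)
  have IH: "(1 - z) * euler_sum n (Suc M) =
      euler_sum (Suc n) (Suc M) - z ^ Suc M * ((1 - w) * parts_gf (evens_upto (Suc M)))"
    using Suc unfolding e s .
  have r: "euler_sum k (Suc (Suc M)) =
      euler_sum k (Suc M) + fps_X ^ (Suc M * (2 * k + 1)) * parts_gf (evens_upto (Suc M))" for k
    by (simp add: euler_sum_def)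
  show ?case
    unfolding r e distrib_left[of "1 - z"] IH by (simp add: algebra_simps del: power_Suc)
qed

text \<open>Iterates the functional equation \<open>n\<close> times; each boundary term is divisible
  by $q^{M+1}$.\<close>

lemma euler_sum_cong:
  "fps_X ^ Suc M dvd euler_prod (odds_below n) * euler_sum 0 (Suc M) - euler_sum n (Suc M)"
proof (induction n)
  case 0
  show ?case by (simp add: euler_prod_def)
next
  case (Suc n)
  let ?y = "(1 - fps_X ^ (2 * n + 1)) :: int fps"
  have "euler_prod (odds_below (Suc n)) * euler_sum 0 (Suc M) - euler_sum (Suc n) (Suc M) =
      ?y * (euler_prod (odds_below n) * euler_sum 0 (Suc M) - euler_sum n (Suc M))
      + (?y * euler_sum n (Suc M) - euler_sum (Suc n) (Suc M))"
    unfolding euler_prod_odds_Suc by (simp only: algebra_simps)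
  also have "?y * euler_sum n (Suc M) - euler_sum (Suc n) (Suc M) =
      - (fps_X ^ (Suc M * (2 * n + 1)) * parts_gf (evens_upto M))"
    unfolding euler_sum_step by simp
  finally have eq: "euler_prod (odds_below (Suc n)) * euler_sum 0 (Suc M) - euler_sum (Suc n) (Suc M) =
      ?y * (euler_prod (odds_below n) * euler_sum 0 (Suc M) - euler_sum n (Suc M))
      + - (fps_X ^ (Suc M * (2 * n + 1)) * parts_gf (evens_upto M))" .
  have "fps_X ^ Suc M dvd (fps_X ^ (Suc M * (2 * n + 1)) * parts_gf (evens_upto M) :: int fps)"
    by (intro dvd_mult2 le_imp_power_dvd) simp
  then show ?case
    unfolding eq using Suc by (intro dvd_add dvd_mult) simp_all
qed

text \<open>After multiplication by $(q;q^2)_{M+1}$ both series are congruent to 1 modulo $q^{M+1}$,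
  and this product is a unit.\<close>

lemma euler_sum_0_nth:
  assumes "m \<le> M"
  shows "euler_sum 0 (Suc M) $ m = parts_gf {k. odd k} $ m"
proof -
  let ?O = "odds_below (Suc M)" and ?Q = "parts_gf {k. odd k}"
  \<comment> \<open>Only \<open>s = 0\<close> survives modulo $q^{M+1}$: for positive
    \<open>s\<close> the exponents are at least \<open>2 * M + 3\<close>.\<close>
  have "euler_sum (Suc M) (Suc M) - 1 =
      (\<Sum>s\<in>{1..M}. fps_X ^ (s * (2 * Suc M + 1)) * parts_gf (evens_upto s))"
    by (simp add: euler_sum_def lessThan_Suc_atMost atMost_atLeast0 sum.atLeast_Suc_atMost
        parts_gf_empty)
  moreover have "fps_X ^ Suc M dvd \<dots>"
  proof (intro dvd_sum dvd_mult2 le_imp_power_dvd)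
    fix s assume "s \<in> {1..M}"
    then have "1 * (2 * Suc M + 1) \<le> s * (2 * Suc M + 1)" by (intro mult_le_mono1) simp
    then show "Suc M \<le> s * (2 * Suc M + 1)" by simp
  qed
  ultimately have 1: "fps_X ^ Suc M dvd euler_sum (Suc M) (Suc M) - 1" by simp
  have "euler_prod ?O * ?Q = parts_gf ({k. odd k} - ?O)"
    by (rule euler_prod_mult_parts_gf) (auto simp: odds_below_def)
  moreover have "fps_X ^ Suc M dvd parts_gf ({k. odd k} - ?O) - 1"
    by (rule X_power_dvd_parts_gf_minus_1) (auto simp: odds_below_def)
  ultimately have 2: "fps_X ^ Suc M dvd euler_prod ?O * ?Q - 1" by simp
  have "fps_X ^ Suc M dvd (euler_prod ?O * euler_sum 0 (Suc M) - euler_sum (Suc M) (Suc M))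
      + (euler_sum (Suc M) (Suc M) - 1) - (euler_prod ?O * ?Q - 1)"
    by (intro dvd_diff dvd_add euler_sum_cong 1 2)
  then have "fps_X ^ Suc M dvd euler_prod ?O * (euler_sum 0 (Suc M) - ?Q)"
    by (simp add: right_diff_distrib)
  then have "fps_X ^ Suc M dvd parts_gf ?O * (euler_prod ?O * (euler_sum 0 (Suc M) - ?Q))"
    by (rule dvd_mult)
  moreover have "parts_gf ?O * euler_prod ?O = 1"
    using euler_prod_mult_parts_gf_self[of ?O] by (simp add: mult.commute)
  ultimately have "fps_X ^ Suc M dvd euler_sum 0 (Suc M) - ?Q"
    by (simp flip: mult.assoc)
  then show ?thesis using assms by (metis nth_eq_of_X_power_dvd_diff less_Suc_eq_le)
qed

section \<open>The counts as coefficients\<close>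

text \<open>
  Halving all multiplicities (after removing one copy of the largest even part \<open>2 a\<close>) encodes the
  partitions counted by \<open>p_eu_ou_bar\<close> as multisets of parts from this set.
\<close>

definition eu_ou_parts :: "nat \<Rightarrow> nat set" where
  "eu_ou_parts a = evens_upto a \<union> ({k. odd k} - odds_below a)"

text \<open>Dropping the odd parts below \<open>2 * a\<close> costs the factor $(q;q^2)_a$;
  admitting the even parts up to \<open>2 * a\<close> divides by $(q^2;q^2)_a$.\<close>

lemma parts_gf_eu_ou: "parts_gf (eu_ou_parts a) = gauss_R a * parts_gf {k. odd k}"
proof -
  have "euler_prod (evens_upto a) * parts_gf (eu_ou_parts a) =
      parts_gf (eu_ou_parts a - evens_upto a)"
    by (rule euler_prod_mult_parts_gf) (auto simp: eu_ou_parts_def)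
  also have "eu_ou_parts a - evens_upto a = {k. odd k} - odds_below a"
    by (auto simp: eu_ou_parts_def evens_upto_def)
  also have "parts_gf \<dots> = euler_prod (odds_below a) * parts_gf {k. odd k}"
    by (rule euler_prod_mult_parts_gf[symmetric]) (auto simp: odds_below_def)
  finally have "parts_gf (evens_upto a) * (euler_prod (evens_upto a) * parts_gf (eu_ou_parts a)) =
      gauss_R a * parts_gf {k. odd k}"
    by (simp add: gauss_R_def mult_ac)
  moreover have "parts_gf (evens_upto a) * euler_prod (evens_upto a) = 1"
    using euler_prod_mult_parts_gf_self[of "evens_upto a"] by (simp add: mult.commute)
  ultimately show ?thesis by (simp flip: mult.assoc)
qed

text \<open>The factor \<open>fps_X ^ a\<close> accounts for half of the removed even part
  \<open>2 * a\<close>; summands with \<open>a > n\<close> do not reach the coefficient of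
  $q^n$.\<close>

lemma sum_card_eu_ou_parts:
  "(\<Sum>a\<le>n. int (card (parts_in (eu_ou_parts a) (n - a)))) =
   (shanks_sum 0 (Suc n) * parts_gf {k. odd k}) $ n"
proof -
  have "shanks_sum 0 (Suc n) * parts_gf {k. odd k} = (\<Sum>a\<le>n. fps_X ^ a * parts_gf (eu_ou_parts a))"
    by (simp only: shanks_sum_def lessThan_Suc_atMost sum_distrib_right parts_gf_eu_ou mult.assoc
        mult_0_right add_0 mult_1_right)
  then show ?thesis
    by (simp add: fps_sum_nth fps_X_power_mult_nth parts_gf_nth)
qed

lemma nth_partial_sum:
  assumes "(1 - fps_X) * f = (g :: int fps)"
  shows "f $ n = (\<Sum>m\<le>n. g $ m)"
proof (induction n)
  case (Suc n)
  have "g $ Suc n = f $ Suc n - f $ n" by (simp add: left_diff_distrib flip: assms)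
  then show ?case using Suc by simp
qed (simp add: left_diff_distrib flip: assms)

text \<open>Multiplying by $1-q$ removes the part 1 and leaves Euler's sum without its term
  \<open>b = 0\<close>; undoing this turns coefficients into partial sums.\<close>

lemma sum_card_one_or_even_parts:
  "(\<Sum>b=1..n. int (card (parts_in (insert 1 (evens_upto b)) (n - b)))) =
   (\<Sum>m=1..n. parts_gf {k. odd k} $ m)"
proof -
  define H where "H = (\<Sum>b=1..n. fps_X ^ b * parts_gf (insert 1 (evens_upto b)))"
  have step: "(1 - fps_X) * parts_gf (insert 1 (evens_upto b)) = parts_gf (evens_upto b)" for b
  proof -
    have "insert 1 (evens_upto b) - {1} = evens_upto b" by (auto simp: evens_upto_def)
    then show ?thesis using parts_gf_remove[of 1 "insert 1 (evens_upto b)"] by simp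
  qed
  have "(1 - fps_X) * H = (\<Sum>b=1..n. fps_X ^ b * parts_gf (evens_upto b))"
    by (simp only: H_def sum_distrib_left mult.left_commute[of "1 - fps_X"] step)
  also have "\<dots> = euler_sum 0 (Suc n) - 1"
    by (simp add: euler_sum_def lessThan_Suc_atMost atMost_atLeast0 sum.atLeast_Suc_atMost
        parts_gf_empty)
  finally have "H $ n = (\<Sum>m\<le>n. (euler_sum 0 (Suc n) - 1) $ m)"
    by (rule nth_partial_sum)
  \<comment> \<open>The constant coefficient vanishes: the empty partition of 0 cancels the
    subtracted 1.\<close>
  also have "\<dots> = (\<Sum>m=1..n. (euler_sum 0 (Suc n) - 1) $ m)"
  proof -
    have "parts_gf {k. odd k} $ 0 = 1" by (simp add: parts_gf_nth_0)
    then show ?thesis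
      by (simp add: atMost_atLeast0 sum.atLeast_Suc_atMost euler_sum_0_nth)
  qed
  also have "\<dots> = (\<Sum>m=1..n. parts_gf {k. odd k} $ m)"
    by (intro sum.cong) (auto simp: euler_sum_0_nth)
  finally show ?thesis
    by (simp add: H_def fps_sum_nth fps_X_power_mult_nth parts_gf_nth)
qed

section \<open>Partitions as multisets\<close>

definition descending_list :: "nat multiset \<Rightarrow> nat list" where
  "descending_list M = rev (sorted_list_of_multiset M)"

lemma mset_descending_list [simp]: "mset (descending_list M) = M"
  by (simp add: descending_list_def)

lemma set_descending_list [simp]: "set (descending_list M) = set_mset M"
  by (simp flip: set_mset_mset)

lemma count_list_descending_list [simp]: "count_list (descending_list M) x = count M x"
  by (simp flip: count_mset)

lemma descending_list_mset:
  assumes "sorted_wrt (\<ge>) xs"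
  shows "descending_list (mset xs) = xs"
proof -
  have "sorted (rev xs)" using assms by (simp add: sorted_wrt_rev)
  then have "sort xs = rev xs" by (intro properties_for_sort) simp_all
  then show ?thesis by (simp add: descending_list_def)
qed

lemma is_partition_descending_list:
  "is_partition m (descending_list M) \<longleftrightarrow> 0 \<notin># M \<and> sum_mset M = m"
proof -
  have "sorted_wrt (\<ge>) (descending_list M)" by (simp add: descending_list_def sorted_wrt_rev)
  moreover have "sum_list (descending_list M) = sum_mset M"
    by (simp flip: sum_mset_sum_list)
  ultimately show ?thesis by (auto simp: is_partition_def intro!: gr0I)
qed

section \<open>Encoding the two families by multisets with halved multiplicities\<close>

lemma even_multiplicities_imp_double:
  assumes "\<And>x. x \<in># N \<Longrightarrow> even (count N x)"
  obtains M where "N = M + M"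
proof
  define M where "M = Abs_multiset (\<lambda>x. count N x div 2)"
  have "{x. 0 < count N x div 2} \<subseteq> set_mset N" by (auto intro!: count_inI)
  then have "finite {x. 0 < count N x div 2}" by (rule finite_subset) simp
  then have "count M x = count N x div 2" for x by (simp add: M_def)
  moreover have "even (count N x)" for x using assms[of x] by (cases "x \<in># N") (auto simp: not_in_iff)
  ultimately show "N = M + M" by (intro multiset_eqI) (simp add: mult_2[symmetric])
qed

text \<open>\<open>a = 0\<close> stands for a partition with only odd parts: its conventional even
  part 0 is no entry of the list.\<close>

definition largest_even_part :: "nat \<Rightarrow> nat multiset" where
  "largest_even_part a = (if a = 0 then {#} else {#2 * a#})"

text \<open>Every counted partition is the image of some pair \<open>(a, M)\<close> under
  \<open>?g\<close>, so there are at most as many partitions as pairs.\<close>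

lemma p_eu_ou_bar_le: "p_eu_ou_bar (2 * n) \<le> (\<Sum>a\<le>n. card (parts_in (eu_ou_parts a) (n - a)))"
proof -
  let ?D = "SIGMA a:{..n}. parts_in (eu_ou_parts a) (n - a)"
  let ?g = "\<lambda>(a, M). descending_list (M + M + largest_even_part a)"
  have fin: "finite (parts_in (eu_ou_parts a) m)" for a m
    by (rule finite_parts_in) (simp add: eu_ou_parts_def)
  \<comment> \<open>Shared by both cases below: comparing sums gives
    \<open>2 * sum_mset M + 2 * a = 2 * n\<close>.\<close>
  have key: "xs \<in> ?g ` ?D"
    if xs: "is_partition (2 * n) xs" "mset xs = M + M + largest_even_part a"
      and M: "set_mset M \<subseteq> eu_ou_parts a" for xs M a
  proof (intro image_eqI[of _ _ "(a, M)"])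
    have "sum_mset (largest_even_part a) = 2 * a" by (simp add: largest_even_part_def)
    moreover have "sum_mset (mset xs) = 2 * n"
      using xs(1) by (simp add: is_partition_def sum_mset_sum_list)
    ultimately have "sum_mset M + a = n" by (simp add: xs(2))
    then show "(a, M) \<in> ?D" using M by (auto simp: parts_in_def)
    show "xs = ?g (a, M)"
      using xs descending_list_mset[of xs] by (simp add: is_partition_def)
  qed
  have "{xs. eu_ou_bar_partition (2 * n) xs} \<subseteq> ?g ` ?D"
  proof
    fix xs assume "xs \<in> {xs. eu_ou_bar_partition (2 * n) xs}"
    then have xs: "eu_ou_bar_partition (2 * n) xs" by simp
    then have part: "is_partition (2 * n) xs" by (simp add: eu_ou_bar_partition_def)
    then have pos: "0 < x" if "x \<in> set xs" for x using that by (simp add: is_partition_def)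
    show "xs \<in> ?g ` ?D"
    proof (cases "\<exists>x\<in>set xs. even x")
      case True
      define e where "e = largest_even xs"
      have "e \<in> {x \<in> set xs. even x}"
        unfolding e_def largest_even_def using True by (intro Max_in) auto
      then have e: "e \<in> set xs" "even e" by auto
      have e_max: "x \<le> e" if "x \<in> set xs" "even x" for x
        unfolding e_def largest_even_def using that by (intro Max_ge) auto
      have counts: "odd (count (mset xs) e)"
        "\<And>x. x \<in> set xs \<Longrightarrow> x \<noteq> e \<Longrightarrow> even (count (mset xs) x)"
        using xs True by (auto simp: eu_ou_bar_partition_def e_def count_mset)
      have odd_gt: "e < x" if "x \<in> set xs" "odd x" for x
        using xs e that by (auto simp: eu_ou_bar_partition_def)
      \<comment> \<open>Removing one copy of the largest even part makes every multiplicity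
        even.\<close>
      have "even (count (mset xs - {#e#}) x)" if "x \<in># mset xs - {#e#}" for x
      proof (cases "x = e")
        case True
        then show ?thesis using counts(1) by simp
      next
        case False
        then show ?thesis using counts(2)[of x] in_diffD[OF that] by simp
      qed
      then obtain M where M: "mset xs - {#e#} = M + M"
        by (rule even_multiplicities_imp_double)
      from e(2) obtain a where a: "e = 2 * a" by (elim evenE)
      have "0 < a" using pos[OF e(1)] a by simp
      have eq: "mset xs = M + M + {#e#}"
        using M e(1) by (metis insert_DiffM2 set_mset_mset)
      have sub: "x \<in> set xs" if "x \<in># M" for x
        using eq that by (metis set_mset_mset union_iff)
      have "set_mset M \<subseteq> eu_ou_parts a"
      proof
        fix x assume x: "x \<in># M"
        show "x \<in> eu_ou_parts a"
          using sub[OF x] e_max[of x] odd_gt[of x] pos[of x]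
          by (cases "even x") (simp_all add: a eu_ou_parts_def evens_upto_def odds_below_def)
      qed
      moreover have "mset xs = M + M + largest_even_part a"
        using eq \<open>0 < a\<close> by (simp add: largest_even_part_def a)
      ultimately show ?thesis by (intro key[OF part])
    next
      case False
      then have "even (count (mset xs) x)" if "x \<in># mset xs" for x
        using xs that by (simp add: eu_ou_bar_partition_def count_mset)
      then obtain M where M: "mset xs = M + M"
        by (rule even_multiplicities_imp_double)
      have "set_mset M \<subseteq> set xs" using M by (metis set_mset_mset set_mset_union Un_upper1)
      then have "set_mset M \<subseteq> eu_ou_parts 0"
        using False by (auto simp: eu_ou_parts_def)
      then show ?thesis
        using M key[OF part, of M 0] by (simp add: largest_even_part_def)
    qed
  qed
  then have "p_eu_ou_bar (2 * n) \<le> card (?g ` ?D)"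
    unfolding p_eu_ou_bar_def by (intro card_mono finite_imageI finite_SigmaI fin) auto
  also have "\<dots> \<le> card ?D" by (intro card_image_le finite_SigmaI fin) auto
  also have "\<dots> = (\<Sum>a\<le>n. card (parts_in (eu_ou_parts a) (n - a)))"
    using fin by (intro card_SigmaI) auto
  finally show ?thesis .
qed

text \<open>Naming the largest even part \<open>e\<close> and the largest odd part \<open>d\<close>
  evaluates \<open>Max\<close> once for both kinds of partitions constructed below.\<close>

lemma ou_eu_bar_partition_descending_list:
  assumes "0 \<notin># N" "sum_mset N = m" "even e" "odd d" "e \<in># N" "d \<in># N" "d < e"
    and "\<And>x. x \<in># N \<Longrightarrow> even x \<Longrightarrow> d < x \<and> x \<le> e"
    and "\<And>x. x \<in># N \<Longrightarrow> odd x \<Longrightarrow> x \<le> d"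
    and "odd (count N e)" "odd (count N d)"
    and "\<And>x. x \<in># N \<Longrightarrow> x \<noteq> e \<Longrightarrow> x \<noteq> d \<Longrightarrow> even (count N x)"
  shows "ou_eu_bar_partition m (descending_list N)"
proof -
  have "largest_even (descending_list N) = e"
    unfolding largest_even_def using assms by (intro Max_eqI) auto
  moreover have "largest_odd (descending_list N) = d"
    unfolding largest_odd_def using assms by (intro Max_eqI) auto
  moreover have "y < x" if "x \<in># N" "y \<in># N" "even x" "odd y" for x y
    using assms(8)[of x] assms(9)[of y] that by simp
  ultimately show ?thesis
    using assms by (auto simp: ou_eu_bar_partition_def is_partition_descending_list)
qed

text \<open>
  The sum counts the partitions whose only odd part is 1. The partition
  $4 + 3 + 1 + \dots + 1$ is missed by it.
\<close>

lemma p_ou_eu_bar_gt: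
  assumes "n \<ge> 3"
  shows "(\<Sum>b=1..n. card (parts_in (insert 1 (evens_upto b)) (n - b))) < p_ou_eu_bar (2 * n + 1)"
proof -
  let ?D = "SIGMA b:{1..n}. parts_in (insert 1 (evens_upto b)) (n - b)"
  \<comment> \<open>The added copies of \<open>2 * b\<close> and 1 make exactly these two
    multiplicities odd and raise the sum from \<open>2 * (n - b)\<close> to
    \<open>2 * n + 1\<close>.\<close>
  let ?N = "\<lambda>(b, M). M + M + {#2 * b, 1#}"
  let ?g = "\<lambda>p. descending_list (?N p)"
  \<comment> \<open>The parts 4 and 3 sum to \<open>2 * 3 + 1\<close>, and an even number of ones
    fills the rest; no \<open>?N p\<close> with \<open>p\<close> in \<open>?D\<close> contains a
    3.\<close>
  let ?x = "descending_list (replicate_mset (2 * (n - 3)) 1 + {#4, 3#})"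
  have fin: "finite (parts_in (insert 1 (evens_upto b)) m)" for b m
    by (rule finite_parts_in) simp
  have D: "\<exists>b M. p = (b, M) \<and> 1 \<le> b \<and> b \<le> n \<and> set_mset M \<subseteq> insert 1 (evens_upto b) \<and>
      sum_mset M = n - b" if "p \<in> ?D" for p
    using that by (auto simp: parts_in_def)
  have in_B: "?g p \<in> {xs. ou_eu_bar_partition (2 * n + 1) xs}" if p_in: "p \<in> ?D" for p
  proof -
    obtain b M where p: "p = (b, M)" "1 \<le> b" "b \<le> n" "set_mset M \<subseteq> insert 1 (evens_upto b)"
      "sum_mset M = n - b"
      using D[OF p_in] by blast
    have parts: "x = 1 \<or> even x \<and> 0 < x \<and> x \<le> 2 * b" if "x \<in># ?N p" for x
      using that p by (auto simp: evens_upto_def)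
    have "ou_eu_bar_partition (2 * n + 1) (descending_list (?N p))"
    proof (rule ou_eu_bar_partition_descending_list[where e = "2 * b" and d = 1])
      show "0 \<notin># ?N p" using parts by force
      show "1 < x \<and> x \<le> 2 * b" if "x \<in># ?N p" "even x" for x
        using parts[OF that(1)] that(2) by (auto intro: Suc_lessI)
      show "x \<le> 1" if "x \<in># ?N p" "odd x" for x
        using parts[OF that(1)] that(2) by auto
    qed (use p in auto)
    then show ?thesis by simp
  qed
  have x_in_B: "?x \<in> {xs. ou_eu_bar_partition (2 * n + 1) xs}"
    unfolding mem_Collect_eq
    by (rule ou_eu_bar_partition_descending_list[where e = 4 and d = 3])
      (use assms in \<open>auto simp: sum_mset_replicate_mset split: if_splits\<close>)
  have x_notin: "?x \<notin> ?g ` ?D"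
  proof
    assume "?x \<in> ?g ` ?D"
    then obtain p where p: "p \<in> ?D" "?x = ?g p" by blast
    have "3 \<in> set ?x" by simp
    then have "3 \<in># ?N p" unfolding p(2) by simp
    moreover obtain b M where bM: "p = (b, M)" "set_mset M \<subseteq> insert 1 (evens_upto b)"
      using D[OF p(1)] by blast
    ultimately have "3 \<in># M \<or> 3 = 2 * b" by auto
    moreover have "3 \<noteq> 2 * b" by presburger
    ultimately have "3 \<in># M" by blast
    then have "3 \<in> insert 1 (evens_upto b)" using bM(2) by blast
    then show False by (simp add: evens_upto_def)
  qed
  have inj: "inj_on ?g ?D"
  proof (rule inj_onI)
    fix p q assume pq: "p \<in> ?D" "q \<in> ?D" "?g p = ?g q"
    obtain b M where p: "p = (b, M)" "1 \<le> b" using D[OF pq(1)] by blast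
    obtain c L where q: "q = (c, L)" "1 \<le> c" using D[OF pq(2)] by blast
    have "?N p = ?N q" using arg_cong[OF pq(3), of mset] by simp
    then have eq: "M + M + {#2 * b, 1#} = L + L + {#2 * c, 1#}" by (simp add: p q)
    \<comment> \<open>Doubled multisets have even counts, so the parity of the count of
      \<open>2 * b\<close> is decided by the added parts; on the other side this forces
      \<open>2 * b = 2 * c\<close>.\<close>
    have "odd (count (M + M + {#2 * b, 1#}) (2 * b))" using p by simp
    then have "odd (count (L + L + {#2 * c, 1#}) (2 * b))" unfolding eq .
    then have "b = c" by (auto split: if_splits)
    then have "M + M = L + L" using eq by simp
    then have "count (M + M) x = count (L + L) x" for x by simp
    then have "count M x + count M x = count L x + count L x" for x by simp
    then have "count M x = count L x" for x by (metis add_self_div_2)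
    then show "p = q" using \<open>b = c\<close> by (simp add: p q multiset_eqI)
  qed
  have "(\<Sum>b=1..n. card (parts_in (insert 1 (evens_upto b)) (n - b))) = card ?D"
    using fin by (intro card_SigmaI[symmetric]) auto
  also have "\<dots> = card (?g ` ?D)" by (rule card_image[symmetric, OF inj])
  also have "\<dots> < p_ou_eu_bar (2 * n + 1)"
    unfolding p_ou_eu_bar_def
  proof (rule psubset_card_mono[OF finite_ou_eu_bar_partitions])
    show "?g ` ?D \<subset> {xs. ou_eu_bar_partition (2 * n + 1) xs}"
      using in_B x_in_B x_notin by blast
  qed
  finally show ?thesis .
qed

section \<open>Coefficients of Gauss's series\<close>

lemma triangular_inj:
  fixes k l :: nat
  assumes "k * (k + 1) div 2 = l * (l + 1) div 2"
  shows "k = l"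
proof -
  have "2 dvd x * (x + 1)" for x :: nat by simp
  then have eq: "k * (k + 1) = l * (l + 1)"
    using assms by (metis dvd_mult_div_cancel)
  have "x * (x + 1) < y * (y + 1)" if "x < y" for x y :: nat
    using that by (intro mult_strict_mono) auto
  from this[of k l] this[of l k] eq show ?thesis by (cases k l rule: linorder_cases) simp_all
qed

text \<open>A number is triangular for at most one index \<open>k\<close>.\<close>

lemma shanks_sum_0_nth_0_1:
  assumes "m < M"
  shows "shanks_sum 0 M $ m \<in> {0, 1}"
proof -
  define T where "T = {k. k < 2 * M \<and> k * (k + 1) div 2 = m}"
  have "k = l" if "k \<in> T" "l \<in> T" for k l
    by (rule triangular_inj) (use that in \<open>simp add: T_def\<close>)
  moreover have "finite T"
    unfolding T_def by (intro finite_Collect_conjI disjI1 finite_Collect_less_nat)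
  ultimately have "card T \<le> Suc 0"
    using card_le_Suc0_iff_eq[of T] by blast
  then have "card T = 0 \<or> card T = 1" by linarith
  then show ?thesis
    unfolding shanks_sum_0_nth[OF assms] T_def[symmetric] by force
qed

text \<open>The triangular numbers jump from 1 to 3.\<close>

lemma shanks_sum_0_nth_2:
  assumes "2 < M"
  shows "shanks_sum 0 M $ 2 = 0"
proof -
  have "k * (k + 1) div 2 \<noteq> 2" for k :: nat
  proof (cases "k < 2")
    case True
    then have "k = 0 \<or> k = 1" by auto
    then show ?thesis by auto
  next
    case False
    then have "2 * 3 \<le> k * (k + 1)" by (intro mult_le_mono) auto
    then show ?thesis by simp
  qed
  then show ?thesis unfolding shanks_sum_0_nth[OF assms] by simp
qed

section \<open>The inequality\<close>

theorem theorem4p1: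
  fixes n :: nat
  assumes "n \<ge> 3"
  shows "p_eu_ou_bar (2 * n) < p_ou_eu_bar (2 * n + 1)"
proof -
  define Q where "Q m = parts_gf {k. odd k} $ m" for m
  define S where "S = shanks_sum 0 (Suc n)"
  have Q_nonneg: "0 \<le> Q m" for m by (simp add: Q_def parts_gf_nth)
  have Q_0: "Q 0 = 1" by (simp add: Q_def parts_gf_nth_0)
  have Q_pos: "1 \<le> Q m" for m
  proof -
    have "replicate_mset m 1 \<in> parts_in {k. odd k} m"
      by (auto simp: parts_in_def sum_mset_replicate_mset split: if_splits)
    moreover have "finite (parts_in {k. odd k} m)" by (rule finite_parts_in) simp
    ultimately have "0 < card (parts_in {k. odd k} m)" by (auto simp: card_gt_0_iff)
    then show ?thesis by (simp add: Q_def parts_gf_nth)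
  qed
  have "int (p_eu_ou_bar (2 * n)) \<le> (\<Sum>a\<le>n. int (card (parts_in (eu_ou_parts a) (n - a))))"
    using p_eu_ou_bar_le[of n] by (simp flip: of_nat_sum)
  also have "\<dots> = (\<Sum>i\<le>n. S $ i * Q (n - i))"
    unfolding sum_card_eu_ou_parts by (simp add: fps_mult_nth S_def Q_def atLeast0AtMost)
  also have "\<dots> \<le> (\<Sum>i\<in>{..n} - {2}. Q (n - i))"
  proof -
    have "S $ 2 = 0" unfolding S_def using assms by (intro shanks_sum_0_nth_2) simp
    then have "(\<Sum>i\<le>n. S $ i * Q (n - i)) = (\<Sum>i\<in>{..n} - {2}. S $ i * Q (n - i))"
      by (intro sum.mono_neutral_right) auto
    also have "\<dots> \<le> (\<Sum>i\<in>{..n} - {2}. Q (n - i))"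
    proof (rule sum_mono)
      fix i assume "i \<in> {..n} - {2}"
      then have "S $ i \<in> {0, 1}" unfolding S_def by (intro shanks_sum_0_nth_0_1) auto
      then show "S $ i * Q (n - i) \<le> Q (n - i)" using Q_nonneg by auto
    qed
    finally show ?thesis .
  qed
  also have "\<dots> = (\<Sum>i\<le>n. Q (n - i)) - Q (n - 2)"
    using assms by (subst sum_diff1) auto
  also have "(\<Sum>i\<le>n. Q (n - i)) = (\<Sum>m\<le>n. Q m)"
    by (rule sum.reindex_bij_witness[of _ "\<lambda>i. n - i" "\<lambda>i. n - i"]) auto
  \<comment> \<open>The omitted \<open>Q (n - 2)\<close> is at least 1 and so pays for
    \<open>Q 0 = 1\<close>, absent on the right.\<close>
  also have "\<dots> - Q (n - 2) \<le> (\<Sum>m=1..n. Q m)"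
    using Q_pos[of "n - 2"] Q_0 by (simp add: atMost_atLeast0 sum.atLeast_Suc_atMost)
  also have "\<dots> < int (p_ou_eu_bar (2 * n + 1))"
    unfolding Q_def sum_card_one_or_even_parts[symmetric]
    using p_ou_eu_bar_gt[OF assms] by (simp flip: of_nat_sum)
  finally show ?thesis by simp
qed

end
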